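(* Let $p$ be a fixed odd prime and let $q\in\mathbb{C}_p$ with $|q-1|_p<1$, $q\neq 1$. Let the $q$-Euler numbers $\widetilde{E}_{n,q}$ ($n\ge0$) be defined by $$\frac{[2]_q}{qe^{t}+1}=\sum_{n=0}^{\infty}\widetilde{E}_{n,q}\frac{t^n}{n!},\qquad [2]_q=1+q,$$ and let the $q$-Bernoulli numbers with weight $0$ be $$\widetilde{B}_{n,q}=\int_{\mathbb{Z}_p}y^n\,d\mu_q(y)=\lim_{N\to\infty}\frac{1}{[p^N]_q}\sum_{y=0}^{p^N-1}y^n q^y,\qquad [x]_q=\frac{1-q^x}{1-q}.$$ Then for all natural numbers $m,k$, $$[2]_q\sum_{l=0}^{m}\binom{m}{l}(-1)^{m-l}\widetilde{B}_{l+k,q} =\sum_{j=0}^{\max\{k,m\}}\left[q\binom{k}{j}+(-1)^j\binom{m}{j}\right]\sum_{l=0}^{k+m-j}\binom{k+m-j}{l}\widetilde{E}_{k+m-j-l,q}\,\widetilde{B}_{l,q}.$$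
   Context: $\mathbb{C}_p$ is the completion of an algebraic closure of $\mathbb{Q}_p$, $\mathbb{Z}_p$ the ring of $p$-adic integers, and $|\cdot|_p$ the $p$-adic absolute value with $|p|_p=1/p$. The integral $\int_{\mathbb{Z}_p}f\,d\mu_q$ is the $p$-adic $q$-integral (q-Volkenborn integral) defined by the displayed limit. The generating function is a formal power series in $t$. Binomial coefficients $\binom{a}{j}$ with $j>a\ge0$ are $0$. *)

theory Defs
  imports
    "HOL-Algebra.Algebraic_Closure_Type"
    "HOL-Computational_Algebra.Formal_Power_Series"
    "HOL-Analysis.Analysis"
begin

class complete_ultrametric_field = field_char_0 + complete_space +
  fixes absval :: "'a \<Rightarrow> real"
  assumes dist_absval: "dist x y = absval (x - y)"
    and absval_mult: "absval (x * y) = absval x * absval y"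
    and absval_ultrametric: "absval (x + y) \<le> max (absval x) (absval y)"

text \<open>
  \<open>padic_complex_field p TYPE('a)\<close> says that \<open>'a\<close> with its absolute value is $\mathbb{C}_p$, the
  completion of an algebraic closure of $\mathbb{Q}_p$. The type \<open>'a\<close> is complete by its class, so
  the closure \<open>padic_numbers\<close> of the image of the rationals is the completion of $\mathbb{Q}$, that is
  $\mathbb{Q}_p$, and being a completion of a subfield \<open>L\<close> means that \<open>L\<close> is dense.
  A multiplicative ultrametric absolute value with $|p| = 1/p$ restricts on $\mathbb{Q}$ to the
  \<open>p\<close>-adic one, since a Bezout relation shows $|\ell| = 1$ for every prime $\ell \neq p$.
\<close>

definition padic_numbers :: "'a::complete_ultrametric_field set"
  where "padic_numbers = closure (range of_rat)"

definition padic_complex_field :: "nat \<Rightarrow> 'a::complete_ultrametric_field itself \<Rightarrow> bool"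
  where "padic_complex_field p T \<longleftrightarrow>
    Factorial_Ring.prime p \<and>
    absval (of_nat p :: 'a) = 1 / real p \<and>
    (\<exists>L :: 'a set. algebraic_closure (ring_of_type_algebra\<lparr>carrier := L\<rparr>) padic_numbers \<and>
                  closure L = UNIV)"

definition q_number :: "'a::field \<Rightarrow> nat \<Rightarrow> 'a"
  where "q_number q x = (1 - q ^ x) / (1 - q)"

lemma q_number_2: "q \<noteq> 1 \<Longrightarrow> q_number q 2 = 1 + q"
  by (simp add: q_number_def field_simps power2_eq_square)

text \<open>
  The limit depends only on the values of the integrand at the natural numbers, so the integrand
  is given as a function on all of \<open>'a\<close> instead of on $\mathbb{Z}_p$.
\<close>

definition q_volkenborn ::
    "nat \<Rightarrow> 'a::complete_ultrametric_field \<Rightarrow> ('a \<Rightarrow> 'a) \<Rightarrow> 'a"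
  where "q_volkenborn p q f =
    lim (\<lambda>N. 1 / q_number q (p ^ N) * (\<Sum>y = 0..<p ^ N. f (of_nat y) * q ^ y))"

definition q_bernoulli ::
    "nat \<Rightarrow> 'a::complete_ultrametric_field \<Rightarrow> nat \<Rightarrow> 'a"
  where "q_bernoulli p q n = q_volkenborn p q (\<lambda>y. y ^ n)"

definition q_euler :: "'a::field_char_0 \<Rightarrow> nat \<Rightarrow> 'a"
  where "q_euler q n =
    fact n * fps_nth (fps_const (q_number q 2) / (fps_const q * fps_exp 1 + 1)) n"

end

theory Submission
  imports Defs
begin

text \<open>
  Let \<open>T f x = q f(x+1) + f(x)\<close>. The polynomials \<open>E\<^sub>n(x)\<close> generated by
  \<open>[2]\<^sub>q e\<^bsup>xt\<^esup> / (q e\<^sup>t + 1)\<close> satisfy \<open>T E\<^sub>n = [2]\<^sub>q x\<^sup>n\<close>. Since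
  \<open>T (x\<^sup>k (x-1)\<^sup>m) = q x\<^sup>m (x+1)\<^sup>k + x\<^sup>k (x-1)\<^sup>m\<close> and \<open>T\<close> is injective on polynomials for
  \<open>q \<noteq> -1\<close>, expanding the right-hand side binomially gives
  \<open>[2]\<^sub>q x\<^sup>k (x-1)\<^sup>m = \<Sum>\<^sub>j (q (k choose j) + (-1)\<^sup>j (m choose j)) E\<^bsub>k+m-j\<^esub>(x)\<close>.
  The theorem is the image of this polynomial identity under the linear functional sending
  \<open>x\<^sup>n\<close> to the \<open>n\<close>-th \<open>q\<close>-Bernoulli number.
\<close>

text \<open>Written out by coefficients so that replacing \<open>x ^ l\<close> by a number
  \<open>B l\<close> yields the inner sum of the theorem.\<close>

definition q_euler_poly :: "'a::field_char_0 \<Rightarrow> nat \<Rightarrow> 'a poly"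
  where "q_euler_poly q n =
    (\<Sum>l\<le>n. Polynomial.monom (of_nat (n choose l) * q_euler q (n - l)) l)"

lemma poly_q_euler_poly:
  "poly (q_euler_poly q n) x = fact n *
     fps_nth (fps_exp x * (fps_const (q_number q 2) / (fps_const q * fps_exp 1 + 1))) n"
proof -
  have "of_nat (n choose l) * (fact (n - l) * g) * x ^ l = fact n * (x ^ l / fact l * g)"
    if "l \<le> n" for l and g :: 'a
    using that by (simp add: binomial_fact field_simps)
  then show ?thesis
    by (simp add: q_euler_poly_def poly_sum poly_monom q_euler_def fps_mult_nth
        sum_distrib_left atMost_atLeast0)
qed

text \<open>Passing from \<open>x\<close> to \<open>x + 1\<close> multiplies the generating function
  by e^t, so the left side multiplies it by q e^t + 1, which cancels the denominator.\<close>

lemma q_euler_poly_shift: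
  assumes "1 + q \<noteq> 0"
  shows "q * poly (q_euler_poly q n) (x + 1) + poly (q_euler_poly q n) x = q_number q 2 * x ^ n"
proof -
  define D where "D = fps_const q * fps_exp 1 + 1"
  define G where "G = fps_const (q_number q 2) / D"
  \<comment> \<open>The constant term is \<open>q + 1\<close>, so \<open>D\<close> is a unit and the
    quotient is a genuine inverse.\<close>
  have "fps_nth D 0 \<noteq> 0"
    using assms by (simp add: D_def add.commute)
  then have GD: "G * D = fps_const (q_number q 2)"
    by (simp add: G_def fps_divide_unit mult.assoc inverse_mult_eq_1)
  have "q * poly (q_euler_poly q n) (x + 1) + poly (q_euler_poly q n) x
      = fact n * fps_nth (fps_const q * (fps_exp (x + 1) * G) + fps_exp x * G) n"
    by (simp add: poly_q_euler_poly G_def D_def algebra_simps)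
  also have "fps_const q * (fps_exp (x + 1) * G) + fps_exp x * G = fps_exp x * (G * D)"
    by (simp add: D_def fps_exp_add_mult algebra_simps)
  also have "fact n * fps_nth \<dots> n = q_number q 2 * x ^ n"
    by (simp add: GD)
  finally show ?thesis .
qed

text \<open>Substituting \<open>x + 1\<close> preserves degree and leading coefficient, so the
  operator multiplies the leading coefficient of \<open>f - g\<close> by
  \<open>1 + q\<close>.\<close>

lemma poly_shift_combination_inj:
  fixes f g :: "'a::field_char_0 poly"
  assumes "1 + q \<noteq> 0"
    and eq: "\<And>x. q * poly f (x + 1) + poly f x = q * poly g (x + 1) + poly g x"
  shows "f = g"
proof -
  define h where "h = f - g"
  have "poly (Polynomial.smult q (h \<circ>\<^sub>p [:1, 1:]) + h) x = poly 0 x" for x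
    using eq[of x] by (simp add: h_def poly_pcompose algebra_simps)
  then have "Polynomial.smult q (h \<circ>\<^sub>p [:1, 1:]) + h = 0"
    by (metis poly_eq_poly_eq_iff ext)
  then have "Polynomial.coeff (Polynomial.smult q (h \<circ>\<^sub>p [:1, 1:]) + h) (Polynomial.degree h) = 0"
    by simp
  moreover have "Polynomial.coeff (h \<circ>\<^sub>p [:1, 1:]) (Polynomial.degree h) = Polynomial.lead_coeff h"
    using lead_coeff_comp[of "[:1, 1:]" h] by (simp add: degree_pcompose)
  ultimately have "(1 + q) * Polynomial.lead_coeff h = 0"
    by (simp add: algebra_simps)
  then have "h = 0"
    using assms(1) by simp
  then show ?thesis
    by (simp add: h_def)
qed

text \<open>The free bound \<open>N\<close> lets two expansions with different exponents share one
  index range; beyond \<open>k\<close> the binomial coefficient vanishes, so truncated subtraction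
  does no harm.\<close>

lemma power_mult_shift_power_expansion:
  fixes x a :: "'a::comm_ring_1"
  assumes "k \<le> N"
  shows "x ^ m * (x + a) ^ k = (\<Sum>j\<le>N. of_nat (k choose j) * a ^ j * x ^ (k + m - j))"
proof -
  have "x ^ m * (x + a) ^ k = (\<Sum>j\<le>k. of_nat (k choose j) * a ^ j * x ^ (k + m - j))"
    unfolding add.commute[of x a] binomial_ring sum_distrib_left
  proof (intro sum.cong refl)
    fix j assume "j \<in> {..k}"
    then have "x ^ (k + m - j) = x ^ m * x ^ (k - j)"
      by (simp add: add.commute flip: power_add)
    then show "x ^ m * (of_nat (k choose j) * a ^ j * x ^ (k - j))
        = of_nat (k choose j) * a ^ j * x ^ (k + m - j)"
      by (simp add: mult_ac)
  qed
  also have "\<dots> = (\<Sum>j\<le>N. of_nat (k choose j) * a ^ j * x ^ (k + m - j))"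
    using assms by (intro sum.mono_neutral_left) (auto simp: binomial_eq_0)
  finally show ?thesis .
qed

lemma q_euler_poly_expansion:
  fixes q :: "'a::field_char_0"
  assumes "1 + q \<noteq> 0"
  shows "Polynomial.smult (q_number q 2)
      (\<Sum>l\<le>m. Polynomial.monom (of_nat (m choose l) * (-1) ^ (m - l)) (l + k))
    = (\<Sum>j\<le>max k m. Polynomial.smult (q * of_nat (k choose j) + (-1) ^ j * of_nat (m choose j))
        (q_euler_poly q (k + m - j)))"
    (is "?F = ?G")
proof (rule poly_shift_combination_inj[OF assms])
  fix x :: 'a
  have F: "poly ?F y = q_number q 2 * (y ^ k * (y - 1) ^ m)" for y
    unfolding diff_conv_add_uminus binomial_ring
    by (simp add: poly_sum poly_monom sum_distrib_left power_add mult_ac)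
  have "q * poly ?G (x + 1) + poly ?G x
      = (\<Sum>j\<le>max k m. (q * of_nat (k choose j) + (-1) ^ j * of_nat (m choose j)) *
          (q * poly (q_euler_poly q (k + m - j)) (x + 1) + poly (q_euler_poly q (k + m - j)) x))"
    by (simp add: poly_sum sum_distrib_left sum.distrib[symmetric] algebra_simps)
  also have "\<dots> = q_number q 2 *
      (q * (\<Sum>j\<le>max k m. of_nat (k choose j) * 1 ^ j * x ^ (k + m - j)) +
       (\<Sum>j\<le>max k m. of_nat (m choose j) * (-1) ^ j * x ^ (m + k - j)))"
    unfolding q_euler_poly_shift[OF assms]
    by (simp add: sum_distrib_left sum.distrib[symmetric] algebra_simps)
  \<comment> \<open>The expansion is used with \<open>a = 1\<close>, then with \<open>a = -1\<close>
    and \<open>k\<close>, \<open>m\<close> exchanged.\<close>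
  also have "\<dots> = q_number q 2 * (q * (x ^ m * (x + 1) ^ k) + x ^ k * (x + - 1) ^ m)"
    by (simp only: power_mult_shift_power_expansion[symmetric] max.cobounded1 max.cobounded2)
  also have "\<dots> = q * poly ?F (x + 1) + poly ?F x"
    unfolding F by (simp add: algebra_simps)
  finally show "q * poly ?F (x + 1) + poly ?F x = q * poly ?G (x + 1) + poly ?G x"
    by (rule sym)
qed

text \<open>Any sequence \<open>B\<close> defines a linear functional on polynomials, through which
  the polynomial identity can be pushed.\<close>

lemma q_euler_umbral_identity:
  fixes q :: "'a::field_char_0" and B :: "nat \<Rightarrow> 'a"
  assumes "1 + q \<noteq> 0"
  shows "q_number q 2 * (\<Sum>l\<le>m. of_nat (m choose l) * (-1) ^ (m - l) * B (l + k))
    = (\<Sum>j\<le>max k m. (q * of_nat (k choose j) + (-1) ^ j * of_nat (m choose j)) *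
        (\<Sum>l\<le>k + m - j. of_nat ((k + m - j) choose l) * q_euler q (k + m - j - l) * B l))"
proof -
  \<comment> \<open>No polynomial in the identity has degree above \<open>k + m\<close>, so this
    fixed cutoff loses nothing and keeps \<open>L\<close> visibly linear.\<close>
  define L where "L f = (\<Sum>i\<le>k + m. Polynomial.coeff f i * B i)" for f
  have L_sum: "L (\<Sum>i\<in>A. h i) = (\<Sum>i\<in>A. L (h i))" for A :: "nat set" and h
    unfolding L_def coeff_sum sum_distrib_right by (rule sum.swap)
  have L_smult: "L (Polynomial.smult c f) = c * L f" for c f
    by (simp add: L_def sum_distrib_left mult.assoc)
  have L_monom: "L (Polynomial.monom c l) = c * B l" if "l \<le> k + m" for c l
    using that by (simp add: L_def if_distrib[of "\<lambda>z. z * _"] cong: if_cong)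
  have L_euler: "L (q_euler_poly q n) = (\<Sum>l\<le>n. of_nat (n choose l) * q_euler q (n - l) * B l)"
    if "n \<le> k + m" for n
    unfolding q_euler_poly_def L_sum using that by (intro sum.cong) (auto simp: L_monom)
  show ?thesis
    using arg_cong[OF q_euler_poly_expansion[OF assms, of m k], of L]
    by (simp add: L_sum L_smult L_monom L_euler)
qed

theorem theorem6:
  fixes p :: nat and q :: "'a::complete_ultrametric_field" and m k :: nat
  assumes "padic_complex_field p TYPE('a)"
    and "odd p"
    and "absval (q - 1) < 1"
    and "q \<noteq> 1"
  shows "q_number q 2 * (\<Sum>l = 0..m. of_nat (m choose l) * (-1) ^ (m - l) * q_bernoulli p q (l + k))
    = (\<Sum>j = 0..max k m. (q * of_nat (k choose j) + (-1) ^ j * of_nat (m choose j)) *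
        (\<Sum>l = 0..k + m - j. of_nat ((k + m - j) choose l) *
           q_euler q (k + m - j - l) * q_bernoulli p q l))"
proof (cases "1 + q = 0")
  \<comment> \<open>Here \<open>[2]_q = 0\<close>: the left side vanishes, and every
    \<open>q_euler q n\<close> is a coefficient of a quotient with numerator 0.\<close>
  case True
  then have "q_number q 2 = 0"
    using q_number_2[OF \<open>q \<noteq> 1\<close>] by simp
  then show ?thesis
    by (simp add: q_euler_def)
next
  case False
  then show ?thesis
    using q_euler_umbral_identity[of q m "q_bernoulli p q" k] by (simp add: atMost_atLeast0)
qed

end
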